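(* The entropy $h^{(k)}$ of the golden mean shift of finite type on the $k$-tree is strictly increasing in $k$: for all integers $k\ge2$, $h^{(k)}<h^{(k+1)}$.
   Context: For an integer $k\ge2$, the $k$-tree is the set $\Sigma_k^*$ of finite words on $\{0,\dots,k-1\}$, with root the empty word, in which the children of $w$ are the nodes $ws$, $s\in\{0,\dots,k-1\}$. Let $\Delta_n^{(k)}$ be the set of words of length at most $n$, so $|\Delta_n^{(k)}|=1+k+\dots+k^n$. The golden mean shift of finite type on the $k$-tree is the set of labelings of the $k$-tree by $\{0,1\}$ in which no two adjacent nodes (parent and child) are both labeled $1$. Let $B_n^{(k)}$ be the number of labelings of $\Delta_n^{(k)}$ by $\{0,1\}$ with no two adjacent nodes both labeled $1$. The entropy is $h^{(k)}=\lim_{n\to\infty}\log B_n^{(k)}/|\Delta_n^{(k)}|$ (the limit exists). *)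

theory Defs
  imports Complex_Main "HOL-Library.FuncSet"
begin

text \<open>Words are lists of letters below \<open>k\<close>; the children of the node \<open>w\<close> are the nodes
  \<open>w @ [s]\<close>, so the last letter is the one nearest to the leaves.\<close>

definition k_tree :: "nat \<Rightarrow> nat list set" where
  "k_tree k = {w. set w \<subseteq> {0..<k}}"

definition tree_ball :: "nat \<Rightarrow> nat \<Rightarrow> nat list set" where
  "tree_ball k n = {w \<in> k_tree k. length w \<le> n}"

lemma card_tree_ball: "card (tree_ball k n) = (\<Sum>i\<le>n. k ^ i)"
  using card_lists_length_le[of "{0..<k}" n] by (simp add: tree_ball_def k_tree_def)

text \<open>Labelings of a set \<open>D\<close> of nodes are extensional functions on \<open>D\<close>, so that for finite \<open>D\<close>
  they can be counted with \<^const>\<open>card\<close>.\<close>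

definition admissible_labelings :: "nat \<Rightarrow> nat list set \<Rightarrow> (nat list \<Rightarrow> nat) set" where
  "admissible_labelings k D =
     {x \<in> D \<rightarrow>\<^sub>E {0, 1}.
        \<forall>w \<in> D. \<forall>s \<in> {0..<k}. w @ [s] \<in> D \<longrightarrow> \<not> (x w = 1 \<and> x (w @ [s]) = 1)}"

definition golden_mean_shift :: "nat \<Rightarrow> (nat list \<Rightarrow> nat) set" where
  "golden_mean_shift k = admissible_labelings k (k_tree k)"

definition golden_mean_count :: "nat \<Rightarrow> nat \<Rightarrow> nat" where
  "golden_mean_count k n = card (admissible_labelings k (tree_ball k n))"

text \<open>As \<^const>\<open>lim\<close> is unspecified for divergent sequences, facts about this entropy depend on the
  convergence of the sequence, which is not proved here.\<close>

definition golden_mean_entropy :: "nat \<Rightarrow> real" where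
  "golden_mean_entropy k =
     lim (\<lambda>n. ln (real (golden_mean_count k n)) / real (card (tree_ball k n)))"

end

theory Submission
  imports Defs "HOL-Analysis.Harmonic_Numbers"
begin

text \<open>Let \<open>r n\<close> be the proportion of admissible labelings of the ball of radius \<open>n\<close> whose root is
  labeled \<open>0\<close>. Splitting a tree at its root gives \<open>r 0 = 1/2\<close>, \<open>r (n + 1) = 1 / (1 + r n ^ k)\<close> and
  \<open>B n ^ k = r (n + 1) * B (n + 1)\<close>, so that the entropy is the weighted average
  \<open>(1 - 1/k) * (\<Sum>n. - ln (r n) / k ^ n)\<close>. Since \<open>r\<close> takes values in \<open>[1/2, 1]\<close> and
  its recursion is decreasing, \<open>r n \<ge> r 2\<close> for all \<open>n \<ge> 2\<close>. Replacing the terms from \<open>n = 2\<close> on by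
  the one at \<open>n = 2\<close> bounds the average for \<open>k\<close> from above, and dropping those from \<open>n = 3\<close> on bounds
  the average for \<open>k + 1\<close> from below; these two bounds are already in the right order.\<close>

section \<open>Splitting labelings at the root\<close>

text \<open>A set of root labels, rather than a single one, covers both situations met below a root:
  a prescribed label, and with \<open>{0, 1}\<close> no condition at all.\<close>

definition rooted_labelings :: "nat \<Rightarrow> nat \<Rightarrow> nat set \<Rightarrow> (nat list \<Rightarrow> nat) set" where
  "rooted_labelings k n C = {x \<in> admissible_labelings k (tree_ball k n). x [] \<in> C}"

lemma Nil_in_tree_ball [simp]: "[] \<in> tree_ball k n"
  by (simp add: tree_ball_def k_tree_def)

lemma Cons_in_tree_ball_Suc [simp]:
  "s # w \<in> tree_ball k (Suc n) \<longleftrightarrow> s < k \<and> w \<in> tree_ball k n"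
  by (auto simp: tree_ball_def k_tree_def)

lemma tree_ball_0: "tree_ball k 0 = {[]}"
  by (auto simp: tree_ball_def k_tree_def)

text \<open>The first letter of a nonempty word names the child of the root below which it lies, so
  \<open>w\<close> maps to \<open>x (s # w)\<close> under the labeling of that child's subtree.
  Every edge either joins the root to some \<open>[s]\<close> or lies inside one such
  subtree.\<close>

lemma admissible_labelings_Suc_iff:
  "x \<in> admissible_labelings k (tree_ball k (Suc n)) \<longleftrightarrow>
     x \<in> extensional (tree_ball k (Suc n)) \<and> x [] \<in> {0, 1} \<and>
     (\<forall>s<k. (\<lambda>w\<in>tree_ball k n. x (s # w)) \<in> admissible_labelings k (tree_ball k n) \<and>
        \<not> (x [] = 1 \<and> x [s] = 1))"
  (is "?L \<longleftrightarrow> ?R")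
proof
  assume L: ?L
  show ?R
  proof (intro conjI allI impI)
    show "x \<in> extensional (tree_ball k (Suc n))" "x [] \<in> {0, 1}"
      using L unfolding admissible_labelings_def PiE_def by auto
  next
    fix s assume s: "s < k"
    have "x (s # w) \<in> {0, 1}" if "w \<in> tree_ball k n" for w
      using L s that unfolding admissible_labelings_def by (auto dest!: PiE_mem)
    moreover have "\<not> (x (s # w) = 1 \<and> x (s # w @ [t]) = 1)"
      if "w \<in> tree_ball k n" "t < k" "w @ [t] \<in> tree_ball k n" for w t
    proof -
      \<comment> \<open>Prepending \<open>s\<close> commutes with appending \<open>t\<close>, so an
        edge of the smaller ball becomes an edge of the larger one.\<close>
      have "s # w \<in> tree_ball k (Suc n)" "(s # w) @ [t] \<in> tree_ball k (Suc n)"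
        using s that by auto
      with L \<open>t < k\<close> show ?thesis
        unfolding admissible_labelings_def by fastforce
    qed
    ultimately show "(\<lambda>w\<in>tree_ball k n. x (s # w)) \<in> admissible_labelings k (tree_ball k n)"
      unfolding admissible_labelings_def by auto
    have "[] @ [s] \<in> tree_ball k (Suc n)"
      using s by simp
    with L s show "\<not> (x [] = 1 \<and> x [s] = 1)"
      unfolding admissible_labelings_def by fastforce
  qed
next
  assume R: ?R
  have "x w \<in> {0, 1}" if "w \<in> tree_ball k (Suc n)" for w
  proof (cases w)
    case Nil
    then show ?thesis using R by simp
  next
    case (Cons s v)
    with that have "s < k" "v \<in> tree_ball k n" by auto
    with R have "(\<lambda>w\<in>tree_ball k n. x (s # w)) v \<in> {0, 1}"
      unfolding admissible_labelings_def by (blast dest: PiE_mem)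
    with Cons \<open>v \<in> tree_ball k n\<close> show ?thesis by simp
  qed
  moreover have "\<not> (x w = 1 \<and> x (w @ [t]) = 1)"
    if "w \<in> tree_ball k (Suc n)" "t < k" "w @ [t] \<in> tree_ball k (Suc n)" for w t
  proof (cases w)
    case Nil
    then show ?thesis using R that by simp
  next
    case (Cons s v)
    with that have *: "s < k" "v \<in> tree_ball k n" "v @ [t] \<in> tree_ball k n" by auto
    with R have "(\<lambda>w\<in>tree_ball k n. x (s # w)) \<in> admissible_labelings k (tree_ball k n)"
      by blast
    with * \<open>t < k\<close> have "\<not> (x (s # v) = 1 \<and> x (s # v @ [t]) = 1)"
      unfolding admissible_labelings_def by fastforce
    with Cons show ?thesis by simp
  qed
  ultimately show ?L
    using R unfolding admissible_labelings_def PiE_def by auto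
qed

text \<open>Once the root label is fixed, the \<open>k\<close> subtrees are labeled independently.
  The root label only restricts their roots: below a \<open>1\<close> they must be \<open>0\<close>,
  below a \<open>0\<close> they are free.\<close>

lemma card_rooted_labelings_Suc:
  assumes c: "c \<in> {0, 1}"
  shows "card (rooted_labelings k (Suc n) {c}) =
    card (rooted_labelings k n (if c = 1 then {0} else {0, 1})) ^ k"
proof -
  let ?C = "if c = 1 then {0} else {0, 1} :: nat set"
  let ?P = "PiE {0..<k} (\<lambda>_. rooted_labelings k n ?C)"
  let ?f = "\<lambda>x. \<lambda>s\<in>{0..<k}. \<lambda>w\<in>tree_ball k n. x (s # w)"
  let ?g = "\<lambda>y. \<lambda>w\<in>tree_ball k (Suc n). case w of [] \<Rightarrow> c | s # v \<Rightarrow> y s v"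
  have adm: "y \<in> extensional (tree_ball k n)" "y [] \<in> ?C"
    if "y \<in> rooted_labelings k n ?C" for y
    using that unfolding rooted_labelings_def admissible_labelings_def PiE_def by auto
  \<comment> \<open>\<open>?f\<close> cuts a labeling into its subtrees; \<open>?g\<close> puts
    \<open>c\<close> at the root and glues a family back together. The restrictions keep both
    results extensional, so that the maps are mutually inverse.\<close>
  have "bij_betw ?f (rooted_labelings k (Suc n) {c}) ?P"
  proof (rule bij_betw_byWitness[where f' = ?g])
    show "\<forall>x\<in>rooted_labelings k (Suc n) {c}. ?g (?f x) = x"
    proof
      fix x assume x: "x \<in> rooted_labelings k (Suc n) {c}"
      then have ext: "x \<in> extensional (tree_ball k (Suc n))" and "x [] = c"
        unfolding rooted_labelings_def admissible_labelings_def PiE_def by auto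
      then show "?g (?f x) = x"
        by (intro extensionalityI[where A = "tree_ball k (Suc n)"])
           (auto split: list.splits)
    qed
    show "\<forall>y\<in>?P. ?f (?g y) = y"
    proof
      fix y assume y: "y \<in> ?P"
      show "?f (?g y) = y"
      proof (rule extensionalityI[where A = "{0..<k}"])
        fix s assume s: "s \<in> {0..<k}"
        with y have "y s \<in> extensional (tree_ball k n)"
          by (intro adm(1)) auto
        with s show "?f (?g y) s = y s"
          by (intro extensionalityI[where A = "tree_ball k n"]) auto
      qed (use y in \<open>auto simp: PiE_def\<close>)
    qed
    show "?f ` rooted_labelings k (Suc n) {c} \<subseteq> ?P"
    proof (intro image_subsetI PiE_I)
      fix x s assume x: "x \<in> rooted_labelings k (Suc n) {c}" and s: "s \<in> {0..<k}"
      then have "(\<lambda>w\<in>tree_ball k n. x (s # w)) \<in> admissible_labelings k (tree_ball k n)"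
          "x [] = c" "\<not> (x [] = 1 \<and> x [s] = 1)"
        unfolding rooted_labelings_def by (auto simp: admissible_labelings_Suc_iff)
      moreover from this(1) have "(\<lambda>w\<in>tree_ball k n. x (s # w)) [] \<in> {0, 1}"
        unfolding admissible_labelings_def by (blast dest: PiE_mem intro: Nil_in_tree_ball)
      ultimately show "?f x s \<in> rooted_labelings k n ?C"
        using s unfolding rooted_labelings_def by auto
    qed auto
    show "?g ` ?P \<subseteq> rooted_labelings k (Suc n) {c}"
    proof (intro image_subsetI)
      fix y assume y: "y \<in> ?P"
      have "(\<lambda>w\<in>tree_ball k n. ?g y (s # w)) \<in> admissible_labelings k (tree_ball k n)"
        "\<not> (c = 1 \<and> ?g y [s] = 1)" if s: "s < k" for s
      proof -
        from y s have ys: "y s \<in> rooted_labelings k n ?C" by auto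
        have "(\<lambda>w\<in>tree_ball k n. ?g y (s # w)) = y s"
          using adm(1)[OF ys] s by (intro extensionalityI[where A = "tree_ball k n"]) auto
        with ys show "(\<lambda>w\<in>tree_ball k n. ?g y (s # w)) \<in> admissible_labelings k (tree_ball k n)"
          unfolding rooted_labelings_def by simp
        show "\<not> (c = 1 \<and> ?g y [s] = 1)"
          using adm(2)[OF ys] s by auto
      qed
      then show "?g y \<in> rooted_labelings k (Suc n) {c}"
        using c unfolding rooted_labelings_def by (simp add: admissible_labelings_Suc_iff)
    qed
  qed
  then have "card (rooted_labelings k (Suc n) {c}) = card ?P"
    by (rule bij_betw_same_card)
  then show ?thesis
    by (simp add: card_PiE)
qed

lemma finite_rooted_labelings: "finite (rooted_labelings k n C)"
proof -
  have "finite (tree_ball k n)"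
    using finite_lists_length_le[of "{0..<k}" n] by (simp add: tree_ball_def k_tree_def)
  then have "finite (tree_ball k n \<rightarrow>\<^sub>E {0, 1::nat})"
    by (intro finite_PiE) auto
  then show ?thesis
    by (rule rev_finite_subset) (auto simp: rooted_labelings_def admissible_labelings_def)
qed

lemma rooted_labelings_01:
  "rooted_labelings k n {0, Suc 0} = admissible_labelings k (tree_ball k n)"
  unfolding rooted_labelings_def admissible_labelings_def
  by (auto dest: PiE_mem[OF _ Nil_in_tree_ball])

lemma golden_mean_count_eq:
  "golden_mean_count k n = card (rooted_labelings k n {0}) + card (rooted_labelings k n {1})"
proof -
  have "rooted_labelings k n {0, Suc 0} = rooted_labelings k n {0} \<union> rooted_labelings k n {1}"
    "rooted_labelings k n {0} \<inter> rooted_labelings k n {1} = {}"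
    unfolding rooted_labelings_def by auto
  then show ?thesis
    by (simp add: golden_mean_count_def flip: rooted_labelings_01)
       (simp add: card_Un_disjoint finite_rooted_labelings)
qed

lemma card_rooted_labelings_0:
  assumes "c \<in> {0, 1}"
  shows "card (rooted_labelings k 0 {c}) = 1"
proof -
  have "rooted_labelings k 0 {c} = {\<lambda>w\<in>{[]}. c}"
    using assms unfolding rooted_labelings_def admissible_labelings_def tree_ball_0
    by (auto simp: PiE_def extensional_def fun_eq_iff)
  then show ?thesis by simp
qed

section \<open>The entropy as a series\<close>

fun root_ratio :: "nat \<Rightarrow> nat \<Rightarrow> real" where
  "root_ratio k 0 = 1 / 2"
| "root_ratio k (Suc n) = 1 / (1 + root_ratio k n ^ k)"

text \<open>The map sending \<open>r\<close> to \<open>1 / (1 + r ^ k)\<close> takes [0, 1] into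
  [1/2, 1].\<close>

lemma root_ratio_bounds: "1 / 2 \<le> root_ratio k n \<and> root_ratio k n \<le> 1"
proof (induction n)
  case (Suc n)
  then have "0 \<le> root_ratio k n ^ k" "root_ratio k n ^ k \<le> 1"
    by (auto intro: power_le_one)
  then show ?case by (auto simp: field_simps)
qed simp

lemma root_ratio_pos: "0 < root_ratio k n"
  using root_ratio_bounds[of k n] by linarith

text \<open>If the smaller ball has \<open>B\<close> labelings, a proportion \<open>r\<close> of
  them with root \<open>0\<close>, then the larger ball has \<open>B ^ k\<close> with root
  \<open>0\<close> and \<open>(r * B) ^ k\<close> with root \<open>1\<close>. The total
  \<open>(1 + r ^ k) * B ^ k\<close> gives both the recursion of the ratio and the positivity that
  later logarithms need.\<close>

lemma root_ratio_count:
  "golden_mean_count k n > 0 \<and>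
   real (card (rooted_labelings k n {0})) = root_ratio k n * golden_mean_count k n"
proof (induction n)
  case 0
  then show ?case
    by (simp add: golden_mean_count_eq card_rooted_labelings_0)
next
  case (Suc n)
  let ?B = "real (golden_mean_count k n)" and ?r = "root_ratio k n"
  have A: "real (card (rooted_labelings k (Suc n) {0})) = ?B ^ k"
    using card_rooted_labelings_Suc[of 0 k n]
    by (simp add: rooted_labelings_01 golden_mean_count_def)
  have "real (card (rooted_labelings k (Suc n) {1})) = (?r * ?B) ^ k"
    using card_rooted_labelings_Suc[of 1 k n] Suc.IH by simp
  with A have B: "real (golden_mean_count k (Suc n)) = (1 + ?r ^ k) * ?B ^ k"
    by (simp add: golden_mean_count_eq[of k "Suc n"] algebra_simps power_mult_distrib)
  have pos: "?r ^ k > 0" "?B ^ k > 0"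
    using Suc.IH root_ratio_pos by auto
  then have "real (golden_mean_count k (Suc n)) > 0"
    unfolding B by (intro mult_pos_pos) auto
  moreover have "1 + ?r ^ k \<noteq> 0"
    using pos by linarith
  ultimately show ?case
    using A B by simp
qed

text \<open>Both sides count the labelings of the larger ball with root \<open>0\<close>: on the
  left by free choices in the \<open>k\<close> subtrees, on the right as a proportion of the
  total.\<close>

lemma golden_mean_count_Suc:
  "real (golden_mean_count k n) ^ k = root_ratio k (Suc n) * golden_mean_count k (Suc n)"
  using root_ratio_count[of k "Suc n"] card_rooted_labelings_Suc[of 0 k n]
  by (simp add: rooted_labelings_01 golden_mean_count_def)

text \<open>The nonnegative correction by which \<open>ln (B (n + 1))\<close> exceeds
  \<open>k * ln (B n)\<close> is its value at \<open>n + 1\<close>.\<close>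

definition log_ratio :: "nat \<Rightarrow> nat \<Rightarrow> real" where
  "log_ratio k n = - ln (root_ratio k n)"

lemma log_ratio_nonneg: "0 \<le> log_ratio k n"
  using root_ratio_bounds[of k n] root_ratio_pos[of k n] by (simp add: log_ratio_def)

lemma log_ratio_0: "log_ratio k 0 = ln 2"
  by (simp add: log_ratio_def ln_div)

lemma log_ratio_Suc: "log_ratio k (Suc n) = ln (1 + root_ratio k n ^ k)"
proof -
  have "1 + root_ratio k n ^ k > 0"
    using root_ratio_pos[of k n] by (intro add_pos_pos) auto
  then show ?thesis by (simp add: log_ratio_def ln_div)
qed

lemma log_ratio_le_ln2: "log_ratio k n \<le> ln 2"
proof -
  have "ln (1 / 2) \<le> ln (root_ratio k n)"
    using root_ratio_bounds[of k n] root_ratio_pos[of k n] by (subst ln_le_cancel_iff) auto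
  then show ?thesis by (simp add: log_ratio_def ln_div)
qed

text \<open>Taking logarithms in \<open>golden_mean_count_Suc\<close> and dividing by
  \<open>k ^ (n + 1)\<close> makes the increments of the left side the summands; the sum starts at
  \<open>ln 2\<close> because a single node has two labelings.\<close>

lemma ln_golden_mean_count:
  assumes "k \<ge> 1"
  shows "ln (golden_mean_count k n) / k ^ n = (\<Sum>i\<le>n. log_ratio k i / k ^ i)"
proof (induction n)
  case 0
  then show ?case
    by (simp add: golden_mean_count_eq card_rooted_labelings_0 log_ratio_0)
next
  case (Suc n)
  have "k * ln (golden_mean_count k n) = ln (real (golden_mean_count k n) ^ k)"
    using root_ratio_count[of k n] by (simp add: ln_realpow)
  also have "\<dots> = ln (golden_mean_count k (Suc n)) - log_ratio k (Suc n)"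
    unfolding golden_mean_count_Suc log_ratio_def
    using root_ratio_count[of k "Suc n"] root_ratio_pos[of k "Suc n"]
    by (subst ln_mult) auto
  finally have "ln (golden_mean_count k (Suc n)) =
      k * ln (golden_mean_count k n) + log_ratio k (Suc n)" by simp
  then have "ln (golden_mean_count k (Suc n)) / k ^ Suc n =
      ln (golden_mean_count k n) / k ^ n + log_ratio k (Suc n) / k ^ Suc n"
    using assms by (simp add: field_simps)
  with Suc.IH show ?case by simp
qed

lemma log_ratio_term_le: "log_ratio k n / real k ^ n \<le> ln 2 * (1 / k) ^ n"
  using mult_right_mono[OF log_ratio_le_ln2[of k n], of "(1 / k) ^ n"]
  by (simp add: power_divide)

lemma summable_log_ratio:
  assumes "k \<ge> 2"
  shows "summable (\<lambda>n. log_ratio k n / real k ^ n)"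
proof (rule summable_comparison_test')
  show "summable (\<lambda>n. ln 2 * (1 / real k) ^ n)"
    using assms by (intro summable_mult summable_geometric) simp
  show "norm (log_ratio k n / real k ^ n) \<le> ln 2 * (1 / real k) ^ n" if "n \<ge> 0" for n
    using log_ratio_term_le[of k n] log_ratio_nonneg[of k n] by simp
qed

text \<open>Dividing numerator and denominator by \<open>k ^ n\<close> turns them into partial sums
  of the series and of a geometric series with sum \<open>1 / (1 - 1/k)\<close>. The quotient is
  thereby shown to converge, so \<open>lim\<close> denotes its genuine limit.\<close>

lemma golden_mean_entropy_eq:
  assumes k: "k \<ge> 2"
  shows "golden_mean_entropy k = (1 - 1 / k) * (\<Sum>n. log_ratio k n / real k ^ n)"
proof -
  have "(\<lambda>n. \<Sum>i\<le>n. log_ratio k i / real k ^ i) \<longlonglongrightarrow> (\<Sum>n. log_ratio k n / real k ^ n)"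
    using summable_log_ratio[OF k] by (rule summable_LIMSEQ')
  then have 1: "(\<lambda>n. ln (golden_mean_count k n) / k ^ n) \<longlonglongrightarrow> (\<Sum>n. log_ratio k n / real k ^ n)"
    using k by (simp add: ln_golden_mean_count)
  have "(\<lambda>n. \<Sum>i\<le>n. (1 / real k) ^ i) \<longlonglongrightarrow> (\<Sum>i. (1 / real k) ^ i)"
    using k by (intro summable_LIMSEQ' summable_geometric) simp
  moreover have "(\<Sum>i. (1 / real k) ^ i) = 1 / (1 - 1 / k)"
    using k by (intro suminf_geometric) simp
  moreover have "(\<Sum>i\<le>n. (1 / real k) ^ i) = card (tree_ball k n) / k ^ n" for n
  proof -
    have "real (card (tree_ball k n)) / k ^ n = (\<Sum>i\<le>n. real k ^ i / k ^ n)"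
      by (simp add: card_tree_ball sum_divide_distrib)
    also have "\<dots> = (\<Sum>i\<le>n. (1 / real k) ^ (n - i))"
      using k by (intro sum.cong) (auto simp: power_diff power_divide field_simps)
    also have "\<dots> = (\<Sum>i\<le>n. (1 / real k) ^ i)"
      by (rule sum.nat_diff_reindex[where n = "Suc n", simplified lessThan_Suc_atMost, simplified])
    finally show ?thesis by simp
  qed
  ultimately have 2: "(\<lambda>n. card (tree_ball k n) / k ^ n) \<longlonglongrightarrow> 1 / (1 - 1 / k)"
    by simp
  have "(\<lambda>n. (ln (golden_mean_count k n) / k ^ n) / (card (tree_ball k n) / k ^ n))
      \<longlonglongrightarrow> (\<Sum>n. log_ratio k n / real k ^ n) / (1 / (1 - 1 / k))"
    using k by (intro tendsto_divide 1 2) auto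
  then have "(\<lambda>n. ln (golden_mean_count k n) / card (tree_ball k n))
      \<longlonglongrightarrow> (1 - 1 / k) * (\<Sum>n. log_ratio k n / real k ^ n)"
    using k by (simp add: mult.commute)
  then show ?thesis
    unfolding golden_mean_entropy_def by (rule limI)
qed

section \<open>Comparing the entropies\<close>

lemma root_ratio_antimono:
  "root_ratio k m \<le> root_ratio k n \<Longrightarrow> root_ratio k (Suc n) \<le> root_ratio k (Suc m)"
  using root_ratio_pos[of k m] root_ratio_pos[of k n]
  by (auto intro!: divide_left_mono power_mono mult_pos_pos add_pos_pos zero_less_power)

text \<open>The ratio starts at its least possible value 1/2, so one application of the decreasing
  recursion makes the ratio at 1 an upper bound from then on, and a second makes the ratio at 2 a
  lower bound.\<close>

lemma log_ratio_le_2: "log_ratio k (n + 2) \<le> log_ratio k 2"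
proof -
  have "root_ratio k (Suc n) \<le> root_ratio k (Suc 0)"
    using root_ratio_bounds by (intro root_ratio_antimono) simp
  then have "root_ratio k 2 \<le> root_ratio k (n + 2)"
    using root_ratio_antimono[of k "Suc n" "Suc 0"] by (simp add: numeral_2_eq_2)
  then show ?thesis
    unfolding log_ratio_def using ln_mono[OF _ root_ratio_pos] by simp
qed

text \<open>The geometric majorant of the tail contributes the factor \<open>1 / (1 - 1/k)\<close>,
  which cancels the weight in front of the series; hence the last summand carries no such
  weight.\<close>

lemma golden_mean_entropy_le:
  assumes k: "k \<ge> 2"
  shows "golden_mean_entropy k \<le>
    (1 - 1 / k) * (ln 2 + log_ratio k 1 / k) + log_ratio k 2 / k\<^sup>2"
proof -
  let ?t = "\<lambda>n. log_ratio k n / real k ^ n"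
  have geo: "(\<lambda>n. log_ratio k 2 / k\<^sup>2 * (1 / real k) ^ n) sums
      (log_ratio k 2 / k\<^sup>2 * (1 / (1 - 1 / k)))"
    using k by (intro sums_mult geometric_sums) simp
  have "?t (n + 2) \<le> log_ratio k 2 / k\<^sup>2 * (1 / real k) ^ n" for n
    using divide_right_mono[OF log_ratio_le_2[of k n], of "real k ^ (n + 2)"]
    by (simp add: power_add power_divide power2_eq_square mult_ac)
  then have "(\<Sum>n. ?t (n + 2)) \<le> log_ratio k 2 / k\<^sup>2 * (1 / (1 - 1 / k))"
    using geo summable_log_ratio[OF k]
    by (intro sums_le[OF _ summable_sums geo] allI summable_ignore_initial_segment) auto
  moreover have "(\<Sum>n. ?t n) = (\<Sum>n. ?t (n + 2)) + (ln 2 + log_ratio k 1 / k)"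
    using suminf_split_initial_segment[OF summable_log_ratio[OF k], of 2]
    by (simp add: numeral_2_eq_2 log_ratio_0)
  ultimately have "(\<Sum>n. ?t n) \<le>
      log_ratio k 2 / k\<^sup>2 * (1 / (1 - 1 / k)) + (ln 2 + log_ratio k 1 / k)"
    by simp
  then have "(1 - 1 / k) * (\<Sum>n. ?t n) \<le>
      (1 - 1 / k) * (log_ratio k 2 / k\<^sup>2 * (1 / (1 - 1 / k)) + (ln 2 + log_ratio k 1 / k))"
    using k by (intro mult_left_mono) auto
  also have "\<dots> = (1 - 1 / k) * (ln 2 + log_ratio k 1 / k) + log_ratio k 2 / k\<^sup>2"
    using k by (simp add: distrib_left)
  finally show ?thesis
    using golden_mean_entropy_eq[OF k] by simp
qed

lemma golden_mean_entropy_ge: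
  assumes k: "k \<ge> 2"
  shows "(1 - 1 / k) * (ln 2 + log_ratio k 1 / k + log_ratio k 2 / k\<^sup>2) \<le> golden_mean_entropy k"
proof -
  have "(\<Sum>n<3. log_ratio k n / real k ^ n) \<le> (\<Sum>n. log_ratio k n / real k ^ n)"
    using summable_log_ratio[OF k] by (intro sum_le_suminf) (auto simp: log_ratio_nonneg)
  then show ?thesis
    unfolding golden_mean_entropy_eq[OF k] using k
    by (intro mult_left_mono) (auto simp: numeral_3_eq_3 numeral_2_eq_2 log_ratio_0)
qed

section \<open>Estimates for the first terms and a sufficient condition\<close>

lemma log_ratio_1: "log_ratio k 1 = ln (1 + (1 / 2) ^ k)"
  using log_ratio_Suc[of k 0] by simp

lemma log_ratio_2: "log_ratio k 2 = ln (1 + (1 / (1 + (1 / 2) ^ k)) ^ k)"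
  using log_ratio_Suc[of k 1] by (simp add: numeral_2_eq_2)

text \<open>Both are equalities at \<open>k = 5\<close>; afterwards the right sides double at each
  step and the left sides grow by less. They serve to bound \<open>(k - 1) / 2 ^ k\<close> by 1/8
  and \<open>k / 2 ^ k\<close> by 5/32.\<close>

lemma linear_le_two_power:
  assumes "k \<ge> 5"
  shows "8 * (real k - 1) \<le> 2 ^ k" and "32 * real k \<le> 5 * 2 ^ k"
proof -
  have "8 * (real k - 1) \<le> 2 ^ k \<and> 32 * real k \<le> 5 * 2 ^ k"
    using assms by (induction k rule: dec_induct) auto
  then show "8 * (real k - 1) \<le> 2 ^ k" "32 * real k \<le> 5 * 2 ^ k" by auto
qed

text \<open>With \<open>x = (1/2) ^ k\<close>, Bernoulli's inequality gives \<open>(1 / (1 + x)) ^ k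
  \<ge> (1 - x) ^ k \<ge> 1 - k * x \<ge> 27/32\<close>.\<close>

lemma log_ratio_2_ge_half:
  assumes "k \<ge> 5"
  shows "1 / 2 \<le> log_ratio k 2"
proof -
  define x :: real where "x = (1 / 2) ^ k"
  have x: "0 < x" "k * x \<le> 5 / 32"
    using linear_le_two_power(2)[OF assms] by (auto simp: x_def power_divide field_simps)
  then have "x \<le> 1"
    by (simp add: x_def power_le_one)
  have "27 / 32 \<le> 1 + k * (- x)"
    using x by simp
  also have "\<dots> \<le> (1 + (- x)) ^ k"
    using \<open>x \<le> 1\<close> by (intro Bernoulli_inequality) simp
  also have "\<dots> \<le> (1 / (1 + x)) ^ k"
    using x \<open>x \<le> 1\<close> by (intro power_mono) (auto simp: field_simps)
  finally have "59 / 32 \<le> 1 + (1 / (1 + x)) ^ k" by simp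
  \<comment> \<open>By squaring: e is at most 3, which is less than
    \<open>(59/32) ^ 2\<close>.\<close>
  moreover have "exp (1 / 2 :: real) \<le> 59 / 32"
  proof (rule power2_le_imp_le)
    have "exp (1 / 2 :: real) ^ 2 = exp 1"
      by (simp flip: exp_of_nat_mult)
    also have "\<dots> \<le> 3" by (rule exp_le)
    finally show "exp (1 / 2 :: real) ^ 2 \<le> (59 / 32) ^ 2"
      by (simp add: power2_eq_square)
  qed simp
  ultimately have "exp (1 / 2) \<le> 1 + (1 / (1 + x)) ^ k" by linarith
  moreover from this have "0 < 1 + (1 / (1 + x)) ^ k"
    using exp_gt_zero[of "1 / 2 :: real"] by linarith
  ultimately show ?thesis
    unfolding log_ratio_2 x_def[symmetric] by (subst ln_ge_iff)
qed

text \<open>The upper bound for \<open>k\<close>, with \<open>log_ratio k 1\<close> replaced by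
  \<open>(1/2) ^ k\<close>, is set against the lower bound for \<open>k + 1\<close>, with its first
  two logarithmic terms after \<open>ln 2\<close> replaced by 0 and 1/2. Subtracting
  \<open>(1 - 1/k) * ln 2\<close> and multiplying by \<open>k ^ 2\<close> leaves the hypothesis.
  From \<open>k = 4\<close> on, the bound 1/2 is available at \<open>k + 1\<close>.\<close>

lemma golden_mean_entropy_less_of_log_ratio:
  assumes k: "k \<ge> 4"
    and less: "log_ratio k 2 + (k - 1) * (1 / 2) ^ k < ln 2 * (k / (k + 1)) + (k / (k + 1)) ^ 3 / 2"
  shows "golden_mean_entropy k < golden_mean_entropy (k + 1)"
proof -
  define K where "K = real k"
  have K: "K \<ge> 4" using k by (simp add: K_def)
  have L1: "log_ratio k 1 \<le> (1 / 2) ^ k"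
    unfolding log_ratio_1 by (rule ln_add_one_self_le_self) simp
  have "golden_mean_entropy k \<le> (1 - 1 / K) * (ln 2 + log_ratio k 1 / K) + log_ratio k 2 / K\<^sup>2"
    using golden_mean_entropy_le[of k] k by (simp add: K_def)
  also have "\<dots> \<le> (1 - 1 / K) * (ln 2 + (1 / 2) ^ k / K) + log_ratio k 2 / K\<^sup>2"
    using L1 K by (intro add_mono mult_left_mono divide_right_mono) auto
  also have "\<dots> = (1 - 1 / K) * ln 2 + (log_ratio k 2 + (K - 1) * (1 / 2) ^ k) / K\<^sup>2"
    using K by (simp add: field_simps power2_eq_square)
  also have "\<dots> < (1 - 1 / K) * ln 2 + (ln 2 * (K / (K + 1)) + (K / (K + 1)) ^ 3 / 2) / K\<^sup>2"
    using less K k by (intro add_strict_left_mono divide_strict_right_mono)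
      (auto simp: K_def of_nat_diff add.commute)
  \<comment> \<open>The zero term keeps the shape of the three-term lower bound for a termwise
    comparison. The \<open>ln 2\<close> parts match because
    \<open>1 / (K * (K + 1)) = 1 / K - 1 / (K + 1)\<close>.\<close>
  also have "\<dots> = (1 - 1 / (K + 1)) * (ln 2 + 0 / (K + 1) + (1 / 2) / (K + 1)\<^sup>2)"
  proof -
    have nz: "K \<noteq> 0" "K + 1 \<noteq> 0" using K by auto
    then have 1: "1 - 1 / K + K / (K + 1) / K\<^sup>2 = 1 - 1 / (K + 1)"
      by (simp add: divide_simps power2_eq_square) algebra
    have 2: "(K / (K + 1)) ^ 3 / 2 / K\<^sup>2 = (1 - 1 / (K + 1)) * ((1 / 2) / (K + 1)\<^sup>2)"
      using nz by (simp add: divide_simps power2_eq_square power3_eq_cube)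
    have "(1 - 1 / K) * ln 2 + (ln 2 * (K / (K + 1)) + (K / (K + 1)) ^ 3 / 2) / K\<^sup>2
        = (1 - 1 / K + K / (K + 1) / K\<^sup>2) * ln 2 + (K / (K + 1)) ^ 3 / 2 / K\<^sup>2"
      by (simp only: add_divide_distrib distrib_right times_divide_eq_left mult.commute[of "ln 2"]
          add.assoc)
    then show ?thesis
      unfolding 1 2 by (simp add: distrib_left)
  qed
  also have "\<dots> \<le> (1 - 1 / (K + 1)) *
      (ln 2 + log_ratio (k + 1) 1 / (K + 1) + log_ratio (k + 1) 2 / (K + 1)\<^sup>2)"
    using K k log_ratio_nonneg[of "k + 1" 1] log_ratio_2_ge_half[of "k + 1"]
    by (intro mult_left_mono add_mono divide_right_mono) auto
  also have "\<dots> \<le> golden_mean_entropy (k + 1)"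
    using golden_mean_entropy_ge[of "k + 1"] k by (simp add: K_def add.commute)
  finally show ?thesis .
qed

section \<open>The cases k = 2, 3, 4\<close>

text \<open>The inequality required by \<open>golden_mean_entropy_less_of_log_ratio\<close> is false
  at 2 and 3, so there the two bounds are evaluated exactly. They are rational combinations of
  logarithms of rationals; the factor 108 makes the coefficients integers, and exponentiating leaves
  a comparison of rationals.\<close>

lemma golden_mean_entropy_2_less_3: "golden_mean_entropy 2 < golden_mean_entropy 3"
proof -
  have "ln ((5/4) ^ 27 * (41/25) ^ 27 :: real) < ln (2 ^ 18 * (9/8) ^ 24 * (1241/729) ^ 8)"
    by (subst ln_less_cancel_iff) (simp_all add: field_simps)
  then have "27 * ln (5/4) + 27 * ln (41/25) < 18 * ln 2 + 24 * ln (9/8) + 8 * ln (1241/729 :: real)"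
    by (simp add: ln_mult ln_realpow del: power_numeral)
  moreover have "108 * golden_mean_entropy 2 \<le> 54 * ln 2 + 27 * ln (5/4) + 27 * ln (41/25)"
    using golden_mean_entropy_le[of 2]
    by (simp add: log_ratio_1[simplified] log_ratio_2 power_divide field_simps)
  moreover have "72 * ln 2 + 24 * ln (9/8) + 8 * ln (1241/729) \<le> 108 * golden_mean_entropy 3"
    using golden_mean_entropy_ge[of 3]
    by (simp add: log_ratio_1[simplified] log_ratio_2 power_divide field_simps)
  ultimately show ?thesis by linarith
qed

lemma golden_mean_entropy_3_less_4: "golden_mean_entropy 3 < golden_mean_entropy 4"
proof -
  \<comment> \<open>Here the common denominator is 576, and 48 = 432 - 384 collects the multiples of
    \<open>ln 2\<close>. The fractions are \<open>1241/729 = 1 + (8/9) ^ 3\<close> and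
    \<open>149057/83521 = 1 + (16/17) ^ 4\<close>.\<close>
  have "ln ((9/8) ^ 128 * (1241/729) ^ 64 :: real) <
      ln (2 ^ 48 * (17/16) ^ 108 * (149057/83521) ^ 27)"
    by (subst ln_less_cancel_iff) (simp_all add: field_simps)
  then have "128 * ln (9/8) + 64 * ln (1241/729) <
      48 * ln 2 + 108 * ln (17/16) + 27 * ln (149057/83521 :: real)"
    by (simp add: ln_mult ln_realpow del: power_numeral)
  moreover have "576 * golden_mean_entropy 3 \<le> 384 * ln 2 + 128 * ln (9/8) + 64 * ln (1241/729)"
    using golden_mean_entropy_le[of 3]
    by (simp add: log_ratio_1[simplified] log_ratio_2 power_divide field_simps)
  moreover have "432 * ln 2 + 108 * ln (17/16) + 27 * ln (149057/83521) \<le> 576 * golden_mean_entropy 4"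
    using golden_mean_entropy_ge[of 4]
    by (simp add: log_ratio_1[simplified] log_ratio_2 power_divide field_simps)
  ultimately show ?thesis by linarith
qed

text \<open>The sufficient condition holds at 4, but the crude bound \<open>ln 2\<close> on
  \<open>log_ratio 4 2\<close> is too weak for it; comparing the exact value with
  \<open>ln (9/5)\<close> gains 1/10.\<close>

lemma golden_mean_entropy_4_less_5: "golden_mean_entropy 4 < golden_mean_entropy 5"
proof -
  have "log_ratio 4 2 \<le> ln (2 * (9/10))"
    unfolding log_ratio_2 by (subst ln_le_cancel_iff) (simp_all add: power_divide)
  also have "\<dots> = ln 2 + ln (9/10)"
    by (rule ln_mult_pos) simp_all
  also have "ln (9/10 :: real) \<le> 9/10 - 1"
    by (rule ln_le_minus_one) simp
  finally have "log_ratio 4 2 \<le> ln 2 - 1/10" by simp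
  then have "golden_mean_entropy 4 < golden_mean_entropy (4 + 1)"
    using ln2_le_25_over_36
    by (intro golden_mean_entropy_less_of_log_ratio) (simp_all add: power_divide)
  then show ?thesis by simp
qed

theorem theorem3p7:
  fixes k :: nat
  assumes "k \<ge> 2"
  shows "golden_mean_entropy k < golden_mean_entropy (k + 1)"
proof -
  consider "k = 2" | "k = 3" | "k = 4" | "k \<ge> 5"
    using assms by linarith
  then show ?thesis
  proof cases
    assume "k = 2"
    then show ?thesis using golden_mean_entropy_2_less_3 by simp
  next
    assume "k = 3"
    then show ?thesis using golden_mean_entropy_3_less_4 by simp
  next
    assume "k = 4"
    then show ?thesis using golden_mean_entropy_4_less_5 by simp
  next
    assume k: "k \<ge> 5"
    define q where "q = real k / (real k + 1)"
    \<comment> \<open>\<open>q\<close> increases with \<open>k\<close>, so \<open>k = 5\<close> is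
      the worst case.\<close>
    have "5 / 6 \<le> q"
      using k by (simp add: q_def field_simps)
    then have "ln 2 * (5 / 6) \<le> ln 2 * q" and "(5 / 6) ^ 3 \<le> q ^ 3"
      by (intro mult_left_mono power_mono; simp)+
    moreover have "(real k - 1) * (1 / 2) ^ k \<le> 1 / 8"
      using linear_le_two_power(1)[OF k] by (simp add: power_divide field_simps)
    moreover have "log_ratio k 2 \<le> ln 2"
      by (rule log_ratio_le_ln2)
    \<comment> \<open>It is enough that \<open>ln 2 + 1/8 < 5/6 * ln 2 + 125/432\<close>, that is
      \<open>ln 2 < 71/72\<close>, which follows from \<open>ln 2 \<le> 25/36\<close>.\<close>
    ultimately have "log_ratio k 2 + (real k - 1) * (1 / 2) ^ k <
        ln 2 * q + q ^ 3 / 2"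
      using ln2_le_25_over_36 by (simp only: power3_eq_cube)
    then show ?thesis
      using k unfolding q_def
      by (intro golden_mean_entropy_less_of_log_ratio) (auto simp: of_nat_diff add.commute)
  qed
qed

end
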